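(* The infimum of the diameters of the slices of the closed unit ball of $B_\infty$ is at most $\sqrt 2$; that is, $$\inf\{\operatorname{diam} S(B_{B_\infty},\varphi,\alpha): \varphi\in (B_\infty)^*,\ \alpha>0\}\le\sqrt2 .$$ In particular, $B_\infty$ fails the slice diameter two property, the diameter two property and the strong diameter two property.
   Context: All Banach spaces are real. For a Banach space $X$, $B_X$ is its closed unit ball and $X^*$ its topological dual; for bounded $A\subseteq X$, $\varphi\in X^*$ and $\alpha>0$, the slice is $S(A,\varphi,\alpha)=\{x\in A:\varphi(x)>\sup_{y\in A}\varphi(y)-\alpha\}$. $X$ has the slice diameter two property (resp. the diameter two property, the strong diameter two property) if every slice of $B_X$ (resp. every non-empty relatively weakly open subset of $B_X$, every convex combination of slices of $B_X$) has diameter $2$. A convex combination of slices is a set $\sum_{i=1}^n\lambda_iS_i$ with $S_i$ slices of $B_X$, $\lambda_i\ge0$, $\sum_i\lambda_i=1$. The tree: $T=\{\emptyset\}\cup\{(\alpha_1,\ldots,\alpha_k): k\in\mathbb N,\ \alpha_1,\ldots,\alpha_k\in\mathbb N\}$ is the set of finite sequences of natural numbers, partially ordered by initial-segment extension, with $\emptyset$ the least element. A segment is a non-empty finite interval of $T$, i.e. a set $\{t\in T: s\le t\le s'\}$ with $s\le s'$ in $T$. $JT_\infty$ is the completion of the space of finitely nonzero functions $x:T\to\mathbb R$ under the norm $$\|x\|=\sup\Big(\sum_{i=1}^n\big(\sum_{t\in S_i}x(t)\big)^2\Big)^{1/2},$$ the supremum being over all finite families $\{S_1,\ldots,S_n\}$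 of pairwise disjoint segments of $T$. For $t\in T$, $e_t^*\in JT_\infty^*$ is the coordinate functional determined by $e_t^*(x)=x(t)$ on finitely nonzero $x$. $B_\infty$ is the norm-closed linear span of $\{e_t^*:t\in T\}$ in $JT_\infty^*$; it is a predual of $JT_\infty$. *)

theory Defs
  imports "HOL-Analysis.Analysis" "HOL-Library.Sublist"
begin

definition slice :: "'a::real_normed_vector set \<Rightarrow> ('a \<Rightarrow>\<^sub>L real) \<Rightarrow> real \<Rightarrow> 'a set"
  where "slice A \<phi> \<alpha> = {x \<in> A. blinfun_apply \<phi> x > (SUP y\<in>A. blinfun_apply \<phi> y) - \<alpha>}"

definition ball_slices :: "'a::real_normed_vector set set"
  where "ball_slices = {slice (cball 0 1) \<phi> \<alpha> | \<phi> \<alpha>. \<alpha> > 0}"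

definition weak_topology :: "'a::real_normed_vector topology"
  where "weak_topology =
    topology_generated_by {blinfun_apply \<phi> -` U | (\<phi> :: 'a \<Rightarrow>\<^sub>L real) U. open U}"

definition convex_combinations_of_slices :: "'a::real_normed_vector set set"
  where "convex_combinations_of_slices =
    {{\<Sum>i<n. c i *\<^sub>R s i | s. \<forall>i<n. s i \<in> S i} | (n::nat) c S.
       (\<forall>i<n. S i \<in> ball_slices) \<and> (\<forall>i<n. 0 \<le> c i) \<and> (\<Sum>i<n. c i) = 1}"

definition slice_diameter_two :: "'a::banach itself \<Rightarrow> bool"
  where "slice_diameter_two _ \<longleftrightarrow> (\<forall>S \<in> (ball_slices :: 'a set set). diameter S = 2)"

definition diameter_two :: "'a::banach itself \<Rightarrow> bool"
  where "diameter_two _ \<longleftrightarrow>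
    (\<forall>W :: 'a set. openin (subtopology weak_topology (cball 0 1)) W \<and> W \<noteq> {} \<longrightarrow> diameter W = 2)"

definition strong_diameter_two :: "'a::banach itself \<Rightarrow> bool"
  where "strong_diameter_two _ \<longleftrightarrow>
    (\<forall>C \<in> (convex_combinations_of_slices :: 'a set set). diameter C = 2)"

text \<open>The tree is the type \<^typ>\<open>nat list\<close>, ordered by \<^const>\<open>prefix\<close>.\<close>

definition segments :: "nat list set set"
  where "segments = {{t. prefix s t \<and> prefix t s'} | s s'. prefix s s'}"

definition segment_families :: "nat list set set set"
  where "segment_families = {F. finite F \<and> F \<subseteq> segments \<and> pairwise disjnt F}"

definition family_value :: "(nat list \<Rightarrow> real) \<Rightarrow> nat list set set \<Rightarrow> real"
  where "family_value x F = sqrt (\<Sum>S\<in>F. (\<Sum>t\<in>S. x t)\<^sup>2)"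

text \<open>A supremum of reals, hence meaningful only when \<open>jt_finite x\<close> holds.\<close>

definition jt_norm :: "(nat list \<Rightarrow> real) \<Rightarrow> real"
  where "jt_norm x = (SUP F\<in>segment_families. family_value x F)"

definition jt_finite :: "(nat list \<Rightarrow> real) \<Rightarrow> bool"
  where "jt_finite x \<longleftrightarrow> bdd_above (family_value x ` segment_families)"

definition finitely_nonzero :: "(nat list \<Rightarrow> real) \<Rightarrow> bool"
  where "finitely_nonzero x \<longleftrightarrow> finite {t. x t \<noteq> 0}"

lemma finite_segment: "S \<in> segments \<Longrightarrow> finite S"
proof -
  assume "S \<in> segments"
  then obtain s s' where S: "S = {t. prefix s t \<and> prefix t s'}" by (auto simp: segments_def)
  have "S \<subseteq> set (prefixes s')" using S by auto
  then show "finite S" using finite_subset by blast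
qed

lemma empty_family: "{} \<in> segment_families"
  by (auto simp: segment_families_def)

lemma family_value_L2: "family_value x F = L2_set (\<lambda>S. \<Sum>t\<in>S. x t) F"
  by (simp add: family_value_def L2_set_def)

lemma family_value_triangle:
  "family_value (\<lambda>t. x t + y t) F \<le> family_value x F + family_value y F"
  unfolding family_value_L2 sum.distrib by (rule L2_set_triangle_ineq)

lemma family_value_scale: "family_value (\<lambda>t. c * x t) F = \<bar>c\<bar> * family_value x F"
  unfolding family_value_def sum_distrib_left[symmetric] power_mult_distrib
  by (simp add: real_sqrt_mult)

lemma family_value_le_norm:
  "jt_finite x \<Longrightarrow> F \<in> segment_families \<Longrightarrow> family_value x F \<le> jt_norm x"
  unfolding jt_norm_def jt_finite_def by (rule cSUP_upper)

lemma jt_norm_le: "(\<And>F. F \<in> segment_families \<Longrightarrow> family_value x F \<le> B) \<Longrightarrow> jt_norm x \<le> B"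
  unfolding jt_norm_def using empty_family by (intro cSUP_least) auto

lemma jt_finiteI: "(\<And>F. F \<in> segment_families \<Longrightarrow> family_value x F \<le> B) \<Longrightarrow> jt_finite x"
  unfolding jt_finite_def bdd_above_def by blast

lemma family_value_add_le:
  assumes "jt_finite x" "jt_finite y" "F \<in> segment_families"
  shows "family_value (\<lambda>t. x t + y t) F \<le> jt_norm x + jt_norm y"
  using family_value_triangle[of x y F] family_value_le_norm[OF assms(1,3)]
    family_value_le_norm[OF assms(2,3)] by linarith

lemma jt_finite_add: "jt_finite x \<Longrightarrow> jt_finite y \<Longrightarrow> jt_finite (\<lambda>t. x t + y t)"
  by (rule jt_finiteI[where B="jt_norm x + jt_norm y"]) (rule family_value_add_le)

lemma jt_norm_add:
  "jt_finite x \<Longrightarrow> jt_finite y \<Longrightarrow> jt_norm (\<lambda>t. x t + y t) \<le> jt_norm x + jt_norm y"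
  by (rule jt_norm_le) (rule family_value_add_le)

lemma jt_finite_scale: "jt_finite x \<Longrightarrow> jt_finite (\<lambda>t. c * x t)"
  by (rule jt_finiteI[where B="\<bar>c\<bar> * jt_norm x"])
     (simp add: family_value_scale mult_left_mono family_value_le_norm)

lemma jt_norm_scale_le: "jt_finite x \<Longrightarrow> jt_norm (\<lambda>t. c * x t) \<le> \<bar>c\<bar> * jt_norm x"
  by (rule jt_norm_le) (simp add: family_value_scale mult_left_mono family_value_le_norm)

lemma jt_norm_scale:
  assumes "jt_finite x"
  shows "jt_norm (\<lambda>t. c * x t) = \<bar>c\<bar> * jt_norm x"
proof (cases "c = 0")
  case True
  have "jt_norm (\<lambda>t. 0) = 0"
    by (simp add: jt_norm_def family_value_def cSUP_const empty_family ex_in_conv[symmetric] exI[of _ "{}"])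
  then show ?thesis using True by simp
next
  case False
  have "jt_norm (\<lambda>t. (1/c) * (c * x t)) \<le> \<bar>1/c\<bar> * jt_norm (\<lambda>t. c * x t)"
    by (intro jt_norm_scale_le jt_finite_scale assms)
  then have "jt_norm x \<le> \<bar>1/c\<bar> * jt_norm (\<lambda>t. c * x t)" using False by simp
  then have "\<bar>c\<bar> * jt_norm x \<le> jt_norm (\<lambda>t. c * x t)"
    using False by (simp add: field_simps)
  then show ?thesis using jt_norm_scale_le[OF assms, of c] by simp
qed

lemma jt_norm_nonneg: "jt_finite x \<Longrightarrow> 0 \<le> jt_norm x"
  using family_value_le_norm[OF _ empty_family, of x] by (simp add: family_value_def)

lemma abs_le_jt_norm:
  assumes "jt_finite x"
  shows "\<bar>x t\<bar> \<le> jt_norm x"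
proof -
  have "{t} = {r. prefix t r \<and> prefix r t}" by auto
  then have "{t} \<in> segments" unfolding segments_def
    by (intro CollectI exI[of _ t]) simp
  then have "{{t}} \<in> segment_families" by (simp add: segment_families_def)
  from family_value_le_norm[OF assms this] show ?thesis by (simp add: family_value_def)
qed

lemma finitely_nonzero_jt_finite:
  assumes "finitely_nonzero x"
  shows "jt_finite x"
proof (rule jt_finiteI)
  let ?A = "{t. x t \<noteq> 0}"
  fix F assume F: "F \<in> segment_families"
  have fin: "finite F" "\<forall>S\<in>F. finite S" and disj: "\<forall>S\<in>F. \<forall>R\<in>F. S \<noteq> R \<longrightarrow> S \<inter> R = {}"
    using F finite_segment by (auto simp: segment_families_def pairwise_def disjnt_def)
  have "family_value x F \<le> (\<Sum>S\<in>F. \<bar>\<Sum>t\<in>S. x t\<bar>)"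
    unfolding family_value_L2 by (rule L2_set_le_sum_abs)
  also have "\<dots> \<le> (\<Sum>S\<in>F. \<Sum>t\<in>S. \<bar>x t\<bar>)" by (intro sum_mono sum_abs)
  also have "\<dots> = (\<Sum>t\<in>\<Union>F. \<bar>x t\<bar>)"
    using sum.Union_disjoint[OF fin(2) disj, of "\<lambda>t. \<bar>x t\<bar>"] by simp
  also have "\<dots> = (\<Sum>t\<in>\<Union>F \<inter> ?A. \<bar>x t\<bar>)"
    using fin by (intro sum.mono_neutral_right) auto
  also have "\<dots> \<le> (\<Sum>t\<in>?A. \<bar>x t\<bar>)"
    using assms by (intro sum_mono2) (auto simp: finitely_nonzero_def)
  finally show "family_value x F \<le> (\<Sum>t\<in>?A. \<bar>x t\<bar>)" .
qed

lemma finitely_nonzero_add: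
  "finitely_nonzero x \<Longrightarrow> finitely_nonzero y \<Longrightarrow> finitely_nonzero (\<lambda>t. x t + y t)"
  unfolding finitely_nonzero_def
  by (rule finite_subset[of _ "{t. x t \<noteq> 0} \<union> {t. y t \<noteq> 0}"]) auto

lemma finitely_nonzero_scale: "finitely_nonzero x \<Longrightarrow> finitely_nonzero (\<lambda>t. c * x t)"
  unfolding finitely_nonzero_def by (rule finite_subset[of _ "{t. x t \<noteq> 0}"]) auto

text \<open>The type \<open>jt\<close> is $JT_\infty$. The completion of the finitely nonzero functions is realised as their closure inside the
  functions of finite norm. That this is the completion is the content of the instance
  \<open>jt :: banach\<close> together with \<open>norm_jt_of\<close>, \<open>jt_of_linear\<close> and \<open>jt_of_dense\<close> below.\<close>

definition jt_carrier :: "(nat list \<Rightarrow> real) set"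
  where "jt_carrier = {x. jt_finite x \<and>
    (\<forall>\<epsilon>>0. \<exists>y. finitely_nonzero y \<and> jt_norm (\<lambda>t. x t - y t) < \<epsilon>)}"

lemma jt_finite_diff: "jt_finite x \<Longrightarrow> jt_finite y \<Longrightarrow> jt_finite (\<lambda>t. x t - y t)"
  using jt_finite_add[OF _ jt_finite_scale[of y "-1"], of x] by simp

lemma jt_norm_zero: "jt_norm (\<lambda>t. 0) = 0"
  using jt_norm_scale[of "\<lambda>t. 0" 0] finitely_nonzero_jt_finite[of "\<lambda>t. 0"]
  by (simp add: finitely_nonzero_def)

lemma finitely_nonzero_in_jt_carrier: "finitely_nonzero x \<Longrightarrow> x \<in> jt_carrier"
  unfolding jt_carrier_def
  by (auto intro!: finitely_nonzero_jt_finite exI[of _ x] simp: jt_norm_zero)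

lemma jt_carrier_approx:
  assumes "x \<in> jt_carrier" "\<epsilon> > 0"
  obtains y where "finitely_nonzero y" "jt_norm (\<lambda>t. x t - y t) < \<epsilon>"
  using assms unfolding jt_carrier_def by blast

lemma jt_carrier_add:
  assumes "x \<in> jt_carrier" "y \<in> jt_carrier"
  shows "(\<lambda>t. x t + y t) \<in> jt_carrier"
proof -
  have f: "jt_finite x" "jt_finite y" using assms by (auto simp: jt_carrier_def)
  have "\<exists>z. finitely_nonzero z \<and> jt_norm (\<lambda>t. (x t + y t) - z t) < \<epsilon>" if "\<epsilon> > 0" for \<epsilon>
  proof -
    obtain a b where a: "finitely_nonzero a" "jt_norm (\<lambda>t. x t - a t) < \<epsilon>/2"
      and b: "finitely_nonzero b" "jt_norm (\<lambda>t. y t - b t) < \<epsilon>/2"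
      using jt_carrier_approx[OF assms(1) half_gt_zero[OF \<open>\<epsilon> > 0\<close>]]
        jt_carrier_approx[OF assms(2) half_gt_zero[OF \<open>\<epsilon> > 0\<close>]] by metis
    have "jt_norm (\<lambda>t. (x t - a t) + (y t - b t)) \<le> jt_norm (\<lambda>t. x t - a t) + jt_norm (\<lambda>t. y t - b t)"
      using a(1) b(1) f by (simp add: jt_norm_add jt_finite_diff finitely_nonzero_jt_finite)
    also have "\<dots> < \<epsilon>" using a b by simp
    finally have "jt_norm (\<lambda>t. (x t + y t) - (a t + b t)) < \<epsilon>" by (simp add: algebra_simps)
    then show ?thesis using finitely_nonzero_add[OF a(1) b(1)]
      by (intro exI[of _ "\<lambda>t. a t + b t"]) simp
  qed
  then show ?thesis using jt_finite_add[OF f] by (simp add: jt_carrier_def)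
qed

lemma jt_carrier_scale:
  assumes "x \<in> jt_carrier"
  shows "(\<lambda>t. c * x t) \<in> jt_carrier"
proof -
  have f: "jt_finite x" using assms by (auto simp: jt_carrier_def)
  have "\<exists>z. finitely_nonzero z \<and> jt_norm (\<lambda>t. c * x t - z t) < \<epsilon>" if "\<epsilon> > 0" for \<epsilon>
  proof -
    have "\<epsilon> / (\<bar>c\<bar> + 1) > 0" using that by (simp add: add_nonneg_pos)
    then obtain a where a: "finitely_nonzero a" "jt_norm (\<lambda>t. x t - a t) < \<epsilon> / (\<bar>c\<bar> + 1)"
      using assms unfolding jt_carrier_def by blast
    have fa: "jt_finite (\<lambda>t. x t - a t)"
      using a(1) f by (simp add: jt_finite_diff finitely_nonzero_jt_finite)
    have "jt_norm (\<lambda>t. c * (x t - a t)) = \<bar>c\<bar> * jt_norm (\<lambda>t. x t - a t)"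
      using fa by (rule jt_norm_scale)
    also have "\<dots> \<le> (\<bar>c\<bar> + 1) * jt_norm (\<lambda>t. x t - a t)"
      using jt_norm_nonneg[OF fa] by (intro mult_right_mono) auto
    also have "\<dots> < \<epsilon>" using a(2) by (simp add: field_simps add_nonneg_pos)
    finally have "jt_norm (\<lambda>t. c * x t - c * a t) < \<epsilon>" by (simp add: right_diff_distrib)
    then show ?thesis using finitely_nonzero_scale[OF a(1), of c]
      by (intro exI[of _ "\<lambda>t. c * a t"]) simp
  qed
  then show ?thesis using jt_finite_scale[OF f] by (simp add: jt_carrier_def)
qed

typedef jt = jt_carrier
  morphisms jt_coord Abs_jt
  by (rule exI[of _ "\<lambda>t. 0"]) (simp add: finitely_nonzero_in_jt_carrier finitely_nonzero_def)

setup_lifting type_definition_jt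

lemma jt_finite_coord: "jt_finite (jt_coord x)"
  using jt_coord[of x] by (simp add: jt_carrier_def)

instantiation jt :: real_normed_vector
begin

lift_definition zero_jt :: jt is "\<lambda>t. 0"
  by (simp add: finitely_nonzero_in_jt_carrier finitely_nonzero_def)

lift_definition plus_jt :: "jt \<Rightarrow> jt \<Rightarrow> jt" is "\<lambda>x y t. x t + y t"
  by (rule jt_carrier_add)

lift_definition uminus_jt :: "jt \<Rightarrow> jt" is "\<lambda>x t. - x t"
  using jt_carrier_scale[of _ "-1"] by simp

lift_definition minus_jt :: "jt \<Rightarrow> jt \<Rightarrow> jt" is "\<lambda>x y t. x t - y t"
  using jt_carrier_add[OF _ jt_carrier_scale[of _ "-1"]] by simp

lift_definition scaleR_jt :: "real \<Rightarrow> jt \<Rightarrow> jt" is "\<lambda>c x t. c * x t"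
  by (rule jt_carrier_scale)

lift_definition norm_jt :: "jt \<Rightarrow> real" is jt_norm .

definition dist_jt :: "jt \<Rightarrow> jt \<Rightarrow> real" where "dist_jt x y = norm (x - y)"

definition sgn_jt :: "jt \<Rightarrow> jt" where "sgn_jt x = scaleR (inverse (norm x)) x"

definition uniformity_jt :: "(jt \<times> jt) filter"
  where "uniformity_jt = (INF e\<in>{0<..}. principal {(x, y). dist x y < e})"

definition open_jt :: "jt set \<Rightarrow> bool"
  where "open_jt U \<longleftrightarrow> (\<forall>x\<in>U. eventually (\<lambda>(x', y). x' = x \<longrightarrow> y \<in> U) uniformity)"

instance
proof
  fix x y z :: jt and a b :: real and U :: "jt set"
  show "x + y + z = x + (y + z)" by transfer (simp add: add.assoc)
  show "x + y = y + x" by transfer (simp add: add.commute)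
  show "0 + x = x" by transfer simp
  show "- x + x = 0" by transfer simp
  show "x - y = x + - y" by transfer simp
  show "a *\<^sub>R (x + y) = a *\<^sub>R x + a *\<^sub>R y" by transfer (simp add: distrib_left)
  show "(a + b) *\<^sub>R x = a *\<^sub>R x + b *\<^sub>R x" by transfer (simp add: distrib_right)
  show "a *\<^sub>R b *\<^sub>R x = (a * b) *\<^sub>R x" by transfer (simp add: mult.assoc)
  show "1 *\<^sub>R x = x" by transfer simp
  show "dist x y = norm (x - y)" by (rule dist_jt_def)
  show "sgn x = scaleR (inverse (norm x)) x" by (rule sgn_jt_def)
  show "uniformity = (INF e\<in>{0<..}. principal {(x, y :: jt). dist x y < e})"
    by (rule uniformity_jt_def)
  show "open U = (\<forall>x\<in>U. \<forall>\<^sub>F (x', y) in uniformity. x' = x \<longrightarrow> y \<in> U)" by (rule open_jt_def)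
  show "norm x = 0 \<longleftrightarrow> x = 0"
  proof transfer
    fix x assume "x \<in> jt_carrier"
    then have "jt_finite x" by (simp add: jt_carrier_def)
    then show "jt_norm x = 0 \<longleftrightarrow> x = (\<lambda>t. 0)"
      using abs_le_jt_norm[of x] jt_norm_zero by (metis abs_le_zero_iff ext)
  qed
  show "norm (x + y) \<le> norm x + norm y"
    by transfer (simp add: jt_norm_add jt_carrier_def)
  show "norm (a *\<^sub>R x) = \<bar>a\<bar> * norm x"
    by transfer (simp add: jt_norm_scale jt_carrier_def)
qed

end

instance jt :: banach
proof
  fix X :: "nat \<Rightarrow> jt" assume C: "Cauchy X"
  define f where "f n = jt_coord (X n)" for n
  have fin: "jt_finite (f n)" for n by (simp add: f_def jt_finite_coord)
  have dist_eq: "dist (X m) (X n) = jt_norm (\<lambda>t. f m t - f n t)" for m n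
    unfolding dist_jt_def f_def by transfer simp
  have le: "\<bar>f m t - f n t\<bar> \<le> dist (X m) (X n)" for m n t
    unfolding dist_eq by (rule abs_le_jt_norm[OF jt_finite_diff[OF fin fin]])
  have "Cauchy (\<lambda>n. f n t)" for t
    using C le unfolding Cauchy_def dist_real_def by (meson le_less_trans)
  then have "\<exists>l. (\<lambda>n. f n t) \<longlonglongrightarrow> l" for t
    by (simp add: Cauchy_convergent_iff convergent_def)
  then obtain g where g: "\<And>t. (\<lambda>n. f n t) \<longlonglongrightarrow> g t" by metis
  have approx: "\<exists>N. \<forall>n\<ge>N. \<forall>F\<in>segment_families. family_value (\<lambda>t. g t - f n t) F \<le> \<epsilon>"
    if "\<epsilon> > 0" for \<epsilon>
  proof -
    obtain N where N: "\<And>m n. m \<ge> N \<Longrightarrow> n \<ge> N \<Longrightarrow> dist (X m) (X n) < \<epsilon>"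
      using CauchyD[OF C \<open>\<epsilon> > 0\<close>] unfolding dist_norm by blast
    have "family_value (\<lambda>t. g t - f n t) F \<le> \<epsilon>" if n: "n \<ge> N" and F: "F \<in> segment_families" for n F
    proof (rule LIMSEQ_le_const2)
      show "(\<lambda>m. family_value (\<lambda>t. f m t - f n t) F) \<longlonglongrightarrow> family_value (\<lambda>t. g t - f n t) F"
        unfolding family_value_def by (intro tendsto_intros g)
      show "\<exists>K. \<forall>m\<ge>K. family_value (\<lambda>t. f m t - f n t) F \<le> \<epsilon>"
        using N n family_value_le_norm[OF jt_finite_diff[OF fin fin] F] unfolding dist_eq
        by (meson less_imp_le order_trans)
    qed
    then show ?thesis by blast
  qed
  have fd: "jt_finite g"
  proof -
    obtain N where "\<forall>F\<in>segment_families. family_value (\<lambda>t. g t - f N t) F \<le> 1"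
      using approx[of 1] by auto
    then have "jt_finite (\<lambda>t. g t - f N t)" by (intro jt_finiteI) auto
    from jt_finite_add[OF this fin[of N]] show ?thesis by simp
  qed
  have conv: "\<exists>N. \<forall>n\<ge>N. jt_norm (\<lambda>t. g t - f n t) \<le> \<epsilon>" if "\<epsilon> > 0" for \<epsilon>
    using approx[OF that] by (meson jt_norm_le)
  have "\<exists>y. finitely_nonzero y \<and> jt_norm (\<lambda>t. g t - y t) < \<epsilon>" if e: "\<epsilon> > 0" for \<epsilon>
  proof -
    obtain N where N: "jt_norm (\<lambda>t. g t - f N t) \<le> \<epsilon>/2" using conv[of "\<epsilon>/2"] e by auto
    have "f N \<in> jt_carrier" unfolding f_def by (rule jt_coord)
    then obtain y where y: "finitely_nonzero y" "jt_norm (\<lambda>t. f N t - y t) < \<epsilon>/2"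
      using half_gt_zero[OF e] by (rule jt_carrier_approx)
    have "jt_norm (\<lambda>t. (g t - f N t) + (f N t - y t))
        \<le> jt_norm (\<lambda>t. g t - f N t) + jt_norm (\<lambda>t. f N t - y t)"
      by (rule jt_norm_add[OF jt_finite_diff[OF fd fin]
            jt_finite_diff[OF fin finitely_nonzero_jt_finite[OF y(1)]]])
    then show ?thesis using y N by (intro exI[of _ y]) simp
  qed
  then have gc: "g \<in> jt_carrier" using fd by (simp add: jt_carrier_def)
  define L where "L = Abs_jt g"
  have L: "jt_coord L = g" unfolding L_def using gc by (rule Abs_jt_inverse)
  have "dist L (X n) = jt_norm (\<lambda>t. g t - f n t)" for n
    unfolding dist_jt_def L[symmetric] f_def by transfer simp
  then have d: "dist (X n) L = jt_norm (\<lambda>t. g t - f n t)" for n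
    by (simp add: dist_commute)
  have "X \<longlonglongrightarrow> L"
    unfolding lim_sequentially d
  proof (intro allI impI)
    fix r :: real assume r: "r > 0"
    then obtain N where "\<forall>n\<ge>N. jt_norm (\<lambda>t. g t - f n t) \<le> r/2" using conv[of "r/2"] by auto
    then show "\<exists>N. \<forall>n\<ge>N. jt_norm (\<lambda>t. g t - f n t) < r"
      using r by (intro exI[of _ N]) force
  qed
  then show "convergent X" by (auto simp: convergent_def)
qed

definition jt_of :: "(nat list \<Rightarrow> real) \<Rightarrow> jt"
  where "jt_of x = Abs_jt x"

lemma jt_coord_jt_of: "finitely_nonzero x \<Longrightarrow> jt_coord (jt_of x) = x"
  by (simp add: jt_of_def Abs_jt_inverse finitely_nonzero_in_jt_carrier)

lemma norm_jt_of: "finitely_nonzero x \<Longrightarrow> norm (jt_of x) = jt_norm x"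
  by (simp add: norm_jt.rep_eq jt_coord_jt_of)

lemma jt_of_linear:
  assumes "finitely_nonzero x" "finitely_nonzero y"
  shows "jt_of (\<lambda>t. a * x t + b * y t) = a *\<^sub>R jt_of x + b *\<^sub>R jt_of y"
  using assms
  by (simp add: jt_coord_inject[symmetric] jt_coord_jt_of plus_jt.rep_eq scaleR_jt.rep_eq
      finitely_nonzero_add finitely_nonzero_scale)

lemma jt_of_dense: "closure (jt_of ` {x. finitely_nonzero x}) = UNIV"
proof -
  have "\<exists>y\<in>jt_of ` {x. finitely_nonzero x}. dist y x < e" if "e > 0" for x e
  proof -
    obtain y where y: "finitely_nonzero y" "jt_norm (\<lambda>t. jt_coord x t - y t) < e"
      using jt_coord[of x] \<open>e > 0\<close> unfolding jt_carrier_def by blast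
    have "dist x (jt_of y) = jt_norm (\<lambda>t. jt_coord x t - y t)"
      by (simp add: dist_norm norm_jt.rep_eq minus_jt.rep_eq jt_coord_jt_of y)
    then show ?thesis using y by (auto simp: dist_commute)
  qed
  then show ?thesis by (auto simp: closure_approachable)
qed

lift_definition coord_functional :: "nat list \<Rightarrow> jt \<Rightarrow>\<^sub>L real" is "\<lambda>t x. jt_coord x t"
proof (rule bounded_linear_intro[where K=1])
  fix t x y and r :: real
  show "jt_coord (x + y) t = jt_coord x t + jt_coord y t" by (simp add: plus_jt.rep_eq)
  show "jt_coord (r *\<^sub>R x) t = r *\<^sub>R jt_coord x t" by (simp add: scaleR_jt.rep_eq)
  show "norm (jt_coord x t) \<le> norm x * 1"
    by (simp add: norm_jt.rep_eq abs_le_jt_norm jt_finite_coord)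
qed

definition binf_carrier :: "(jt \<Rightarrow>\<^sub>L real) set"
  where "binf_carrier = closure (span (range coord_functional))"

lemma subspace_binf_carrier: "subspace binf_carrier"
proof -
  define V where "V = span (range coord_functional)"
  have V: "subspace V" by (simp add: V_def)
  show ?thesis unfolding binf_carrier_def V_def[symmetric] subspace_def
  proof (intro conjI ballI allI)
    show "0 \<in> closure V" using V subspace_0 closure_subset by blast
    fix x assume "x \<in> closure V"
    then obtain f where f: "\<And>n. f n \<in> V" "f \<longlonglongrightarrow> x" unfolding closure_sequential by blast
    show "c *\<^sub>R x \<in> closure V" for c
      unfolding closure_sequential using f V
      by (intro exI[of _ "\<lambda>n. c *\<^sub>R f n"]) (auto intro: subspace_scale tendsto_intros)
    fix y assume "y \<in> closure V"
    then obtain g where g: "\<And>n. g n \<in> V" "g \<longlonglongrightarrow> y" unfolding closure_sequential by blast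
    show "x + y \<in> closure V"
      unfolding closure_sequential using f g V
      by (intro exI[of _ "\<lambda>n. f n + g n"]) (auto intro: subspace_add tendsto_intros)
  qed
qed

text \<open>$B_\infty$, with the norm of the dual space.\<close>

typedef binf = binf_carrier
  by (rule exI[of _ 0]) (rule subspace_0[OF subspace_binf_carrier])

setup_lifting type_definition_binf

instantiation binf :: real_normed_vector
begin

lift_definition zero_binf :: binf is 0
  by (rule subspace_0[OF subspace_binf_carrier])

lift_definition plus_binf :: "binf \<Rightarrow> binf \<Rightarrow> binf" is "(+)"
  by (rule subspace_add[OF subspace_binf_carrier])

lift_definition uminus_binf :: "binf \<Rightarrow> binf" is uminus
  by (rule subspace_neg[OF subspace_binf_carrier])

lift_definition minus_binf :: "binf \<Rightarrow> binf \<Rightarrow> binf" is "(-)"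
  by (rule subspace_diff[OF subspace_binf_carrier])

lift_definition scaleR_binf :: "real \<Rightarrow> binf \<Rightarrow> binf" is "(*\<^sub>R)"
  by (rule subspace_scale[OF subspace_binf_carrier])

lift_definition norm_binf :: "binf \<Rightarrow> real" is norm .

definition dist_binf :: "binf \<Rightarrow> binf \<Rightarrow> real" where "dist_binf x y = norm (x - y)"

definition sgn_binf :: "binf \<Rightarrow> binf" where "sgn_binf x = scaleR (inverse (norm x)) x"

definition uniformity_binf :: "(binf \<times> binf) filter"
  where "uniformity_binf = (INF e\<in>{0<..}. principal {(x, y). dist x y < e})"

definition open_binf :: "binf set \<Rightarrow> bool"
  where "open_binf U \<longleftrightarrow> (\<forall>x\<in>U. eventually (\<lambda>(x', y). x' = x \<longrightarrow> y \<in> U) uniformity)"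

instance
proof
  fix x y z :: binf and a b :: real and U :: "binf set"
  show "x + y + z = x + (y + z)" by transfer (simp add: add.assoc)
  show "x + y = y + x" by transfer (simp add: add.commute)
  show "0 + x = x" by transfer simp
  show "- x + x = 0" by transfer simp
  show "x - y = x + - y" by transfer simp
  show "a *\<^sub>R (x + y) = a *\<^sub>R x + a *\<^sub>R y" by transfer (simp add: scaleR_add_right)
  show "(a + b) *\<^sub>R x = a *\<^sub>R x + b *\<^sub>R x" by transfer (simp add: scaleR_add_left)
  show "a *\<^sub>R b *\<^sub>R x = (a * b) *\<^sub>R x" by transfer simp
  show "1 *\<^sub>R x = x" by transfer simp
  show "dist x y = norm (x - y)" by (rule dist_binf_def)
  show "sgn x = scaleR (inverse (norm x)) x" by (rule sgn_binf_def)
  show "uniformity = (INF e\<in>{0<..}. principal {(x, y :: binf). dist x y < e})"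
    by (rule uniformity_binf_def)
  show "open U = (\<forall>x\<in>U. \<forall>\<^sub>F (x', y) in uniformity. x' = x \<longrightarrow> y \<in> U)" by (rule open_binf_def)
  show "norm x = 0 \<longleftrightarrow> x = 0" by transfer simp
  show "norm (x + y) \<le> norm x + norm y" by transfer (rule norm_triangle_ineq)
  show "norm (a *\<^sub>R x) = \<bar>a\<bar> * norm x" by transfer simp
qed

end

lemma dist_Rep_binf: "dist (Rep_binf x) (Rep_binf y) = dist x y"
  unfolding dist_norm by transfer simp

instance binf :: banach
proof
  fix X :: "nat \<Rightarrow> binf" assume "Cauchy X"
  then have "Cauchy (\<lambda>n. Rep_binf (X n))" by (simp add: Cauchy_def dist_Rep_binf)
  then obtain l where l: "(\<lambda>n. Rep_binf (X n)) \<longlonglongrightarrow> l"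
    by (auto simp: Cauchy_convergent_iff convergent_def)
  have "closed binf_carrier" by (simp add: binf_carrier_def)
  then have "l \<in> binf_carrier" using l Rep_binf by (metis closed_sequentially)
  then have "Rep_binf (Abs_binf l) = l" by (rule Abs_binf_inverse)
  with l have "X \<longlonglongrightarrow> Abs_binf l" by (metis (no_types, lifting) dist_Rep_binf lim_sequentially)
  then show "convergent X" by (auto simp: convergent_def)
qed

end

theory Submission
  imports Defs
begin

text \<open>
  The slices are those determined by $e = e_\emptyset \in JT_\infty$. If $f, g$ lie in the unit ball
  and $f(e), g(e) > 1 - c^2$, then for $\|x\| \le 1$
  \[ c\,(f - g)(x) \le \|e + c x\| + \|e - c x\| - 2 + 2 c^2. \]
  Up to $O(c^2)$, only the member $S$ of a family of disjoint segments that contains the root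
  contributes to $\|e + c x\|$, which is therefore about $1 + c \sum_{t\in S} x(t)$, and likewise for
  $\|e - c x\|$ with a segment $S'$. Both segments start at the root, so $S \setminus S'$ and
  $S' \setminus S$ are disjoint segments or empty. Hence
  $\sum_{t\in S} x(t) - \sum_{t\in S'} x(t) \le \sqrt 2\,\|x\|$, and the slice has diameter at most
  $\sqrt 2 + 4 c$.
\<close>

section \<open>Segments starting at the root and their differences\<close>

lemma segment_containing_root:
  assumes "S \<in> segments" "[] \<in> S"
  obtains u where "S = {t. prefix t u}"
  using assms by (auto simp: segments_def)

text \<open>The prefixes of \<open>u\<close> form a chain, and among them those that are not
  prefixes of \<open>v\<close> are closed under extension. So they make up the interval from the
  shortest of them to \<open>u\<close>.\<close>

lemma prefixes_diff_segment:
  "{t. prefix t u \<and> \<not> prefix t v} = {} \<or> {t. prefix t u \<and> \<not> prefix t v} \<in> segments"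
proof (cases "prefix u v")
  case True
  then show ?thesis by (auto dest: prefix_order.trans)
next
  case False
  let ?P = "\<lambda>t. prefix t u \<and> \<not> prefix t v"
  define r where "r = (ARG_MIN length t. ?P t)"
  have "?P u" using False by simp
  then have r: "?P r" "\<And>t. ?P t \<Longrightarrow> length r \<le> length t"
    unfolding r_def using arg_min_natI[of ?P u length] arg_min_nat_le[of ?P _ length] by blast+
  have "?P t \<longleftrightarrow> prefix r t \<and> prefix t u" for t
  proof
    assume t: "?P t"
    then show "prefix r t \<and> prefix t u"
      using r(1) r(2)[OF t] by (auto intro: prefix_length_prefix)
  next
    assume "prefix r t \<and> prefix t u"
    then show "?P t" using r(1) prefix_order.trans by blast
  qed
  then have "{t. ?P t} = {t. prefix r t \<and> prefix t u}" by blast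
  then show ?thesis using r(1) unfolding segments_def by blast
qed

lemma disjoint_segments_sum_squares_le:
  assumes "jt_finite x" "A = {} \<or> A \<in> segments" "B = {} \<or> B \<in> segments" "A \<inter> B = {}"
  shows "(sum x A)\<^sup>2 + (sum x B)\<^sup>2 \<le> (jt_norm x)\<^sup>2"
proof -
  \<comment> \<open>The empty set is not a segment, so it is removed; its sum is 0 and the total
    does not change. If \<open>A = B\<close>, disjointness makes both empty.\<close>
  let ?F = "{A, B} - {{}}"
  have "?F \<in> segment_families"
    using assms by (auto simp: segment_families_def pairwise_def disjnt_def)
  from family_value_le_norm[OF assms(1) this]
  have "(\<Sum>S\<in>?F. (sum x S)\<^sup>2) \<le> (jt_norm x)\<^sup>2"
    unfolding family_value_def by (rule sqrt_le_D)
  moreover have "(\<Sum>S\<in>?F. (sum x S)\<^sup>2) = (\<Sum>S\<in>{A, B}. (sum x S)\<^sup>2)"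
    by (rule sum.mono_neutral_left) auto
  moreover have "(\<Sum>S\<in>{A, B}. (sum x S)\<^sup>2) = (sum x A)\<^sup>2 + (sum x B)\<^sup>2"
    using assms(4) by (cases "A = B") auto
  ultimately show ?thesis by simp
qed

text \<open>The common prefixes cancel, leaving the sums a and b over two disjoint sets, each a
  segment or empty. The factor sqrt 2 comes from (a - b)^2 \<le> 2 (a^2 + b^2).\<close>

lemma sum_prefixes_diff_le:
  assumes "jt_finite x"
  shows "sum x {t. prefix t u} - sum x {t. prefix t v} \<le> sqrt 2 * jt_norm x"
proof -
  let ?U = "{t. prefix t u}" and ?V = "{t. prefix t v}"
  let ?A = "{t. prefix t u \<and> \<not> prefix t v}" and ?B = "{t. prefix t v \<and> \<not> prefix t u}"
  have fin: "finite {t. prefix t w}" for w :: "nat list"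
    by (rule finite_subset[of _ "set (prefixes w)"]) auto
  have "sum x ?U = sum x (?U \<inter> ?V) + sum x ?A" "sum x ?V = sum x (?U \<inter> ?V) + sum x ?B"
    by (subst sum.union_disjoint[symmetric]; auto intro: fin finite_subset[OF _ fin]
        intro!: sum.cong)+
  then have eq: "sum x ?U - sum x ?V = sum x ?A - sum x ?B" by simp
  have sq: "(sum x ?A)\<^sup>2 + (sum x ?B)\<^sup>2 \<le> (jt_norm x)\<^sup>2"
    by (rule disjoint_segments_sum_squares_le[OF assms prefixes_diff_segment prefixes_diff_segment])
      auto
  have "(sum x ?A - sum x ?B)\<^sup>2 \<le> 2 * ((sum x ?A)\<^sup>2 + (sum x ?B)\<^sup>2)"
    using zero_le_power2[of "sum x ?A + sum x ?B"] by (simp add: power2_eq_square algebra_simps)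
  also have "\<dots> \<le> (sqrt 2 * jt_norm x)\<^sup>2" using sq by (simp add: power_mult_distrib)
  finally have "(sum x ?A - sum x ?B)\<^sup>2 \<le> (sqrt 2 * jt_norm x)\<^sup>2" .
  then show ?thesis
    unfolding eq by (rule power2_le_imp_le) (simp add: jt_norm_nonneg assms)
qed

section \<open>The norm near the root vector\<close>

definition root_fun :: "nat list \<Rightarrow> real"
  where "root_fun t = (if t = [] then 1 else 0)"

lemma sum_root_fun: "finite S \<Longrightarrow> sum root_fun S = (if [] \<in> S then 1 else 0)"
  unfolding root_fun_def by (simp add: sum.delta)

lemma finitely_nonzero_root_fun: "finitely_nonzero root_fun"
  by (simp add: finitely_nonzero_def root_fun_def)

lemma abs_sum_segment_le:
  assumes "jt_finite x" "S \<in> segments"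
  shows "\<bar>sum x S\<bar> \<le> jt_norm x"
proof -
  have "{S} \<in> segment_families" using assms(2) by (simp add: segment_families_def)
  from family_value_le_norm[OF assms(1) this] show ?thesis by (simp add: family_value_def)
qed

lemma prefixes_segment: "{t. prefix t u} \<in> segments"
  unfolding segments_def by (intro CollectI exI[of _ "[]"] exI[of _ u]) auto

text \<open>Squaring the right side produces the cross term 2 a c^2, which dominates c^2 once 2 a
  \<ge> 1.\<close>

lemma sqrt_sum_squares_perturbation:
  fixes a c :: real
  assumes "1/2 \<le> a"
  shows "sqrt (a\<^sup>2 + c\<^sup>2) \<le> a + c\<^sup>2"
proof (rule real_le_lsqrt)
  have "1 * c\<^sup>2 \<le> (2 * a) * c\<^sup>2" using assms by (intro mult_right_mono) auto
  then show "a\<^sup>2 + c\<^sup>2 \<le> (a + c\<^sup>2)\<^sup>2"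
    using zero_le_power2[of "c\<^sup>2"] unfolding power2_sum by linarith
qed (use assms in auto)

text \<open>By disjointness at most one member of \<open>F\<close> contains the root. The others see
  only \<open>c * x\<close>, so their squares add up to at most c^2, and under the square root this
  costs at most c^2.\<close>

lemma family_value_root_perturbation:
  assumes x: "jt_finite x" "jt_norm x \<le> 1" and c: "0 < c" "c \<le> 1/2"
    and F: "F \<in> segment_families"
  obtains u where
    "family_value (\<lambda>t. root_fun t + c * x t) F \<le> 1 + c * sum x {t. prefix t u} + c\<^sup>2"
proof -
  let ?y = "\<lambda>t. root_fun t + c * x t"
  have fin: "finite F" and seg: "F \<subseteq> segments" and disj: "pairwise disjnt F"
    using F by (auto simp: segment_families_def)
  have sum_y: "sum ?y S = (if [] \<in> S then 1 else 0) + c * sum x S" if "S \<in> F" for S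
    using finite_segment that seg by (auto simp: sum.distrib sum_root_fun sum_distrib_left)
  \<comment> \<open>A segment sum of \<open>x\<close> is at most 1 in absolute value, so c \<le> 1/2
    keeps the main term in the range of \<open>sqrt_sum_squares_perturbation\<close>.\<close>
  have large: "1/2 \<le> 1 + c * sum x {t. prefix t u}" for u
  proof -
    have "\<bar>c * sum x {t. prefix t u}\<bar> \<le> (1/2) * 1"
      unfolding abs_mult using c abs_sum_segment_le[OF x(1) prefixes_segment, of u] x(2)
      by (intro mult_mono) auto
    then show ?thesis by linarith
  qed
  have rest: "(\<Sum>S\<in>G. (sum ?y S)\<^sup>2) \<le> c\<^sup>2" if "G \<subseteq> F" "\<And>S. S \<in> G \<Longrightarrow> [] \<notin> S" for G
  proof -
    have "(\<Sum>S\<in>G. (sum ?y S)\<^sup>2) = c\<^sup>2 * (\<Sum>S\<in>G. (sum x S)\<^sup>2)"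
      unfolding sum_distrib_left using that
      by (intro sum.cong) (auto simp: sum_y power_mult_distrib subset_iff)
    moreover have "G \<in> segment_families"
      using that(1) fin seg disj
      by (auto simp: segment_families_def intro: finite_subset pairwise_subset)
    then have "sqrt (\<Sum>S\<in>G. (sum x S)\<^sup>2) \<le> 1"
      using family_value_le_norm[OF x(1)] x(2) unfolding family_value_def by (meson order_trans)
    then have "c\<^sup>2 * (\<Sum>S\<in>G. (sum x S)\<^sup>2) \<le> c\<^sup>2 * 1" by (intro mult_left_mono) auto
    ultimately show ?thesis by simp
  qed
  have "\<exists>u. (\<Sum>S\<in>F. (sum ?y S)\<^sup>2) \<le> (1 + c * sum x {t. prefix t u})\<^sup>2 + c\<^sup>2"
  proof (cases "\<exists>S\<in>F. [] \<in> S")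
    case True
    then obtain S where S: "S \<in> F" "[] \<in> S" by blast
    obtain u where u: "S = {t. prefix t u}" using segment_containing_root S seg by blast
    have "(\<Sum>S\<in>F. (sum ?y S)\<^sup>2) = (sum ?y S)\<^sup>2 + (\<Sum>S\<in>F - {S}. (sum ?y S)\<^sup>2)"
      using fin S(1) by (rule sum.remove)
    moreover have "(\<Sum>S\<in>F - {S}. (sum ?y S)\<^sup>2) \<le> c\<^sup>2"
      using S disj by (intro rest) (auto simp: pairwise_def disjnt_def)
    moreover have "sum ?y S = 1 + c * sum x {t. prefix t u}"
      using sum_y[OF S(1)] S(2) u by simp
    ultimately have "(\<Sum>S\<in>F. (sum ?y S)\<^sup>2) \<le> (1 + c * sum x {t. prefix t u})\<^sup>2 + c\<^sup>2"
      by simp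
    then show ?thesis ..
  next
    case False
    then have "(\<Sum>S\<in>F. (sum ?y S)\<^sup>2) \<le> c\<^sup>2" by (intro rest) auto
    \<comment> \<open>No member contains the root: any \<open>u\<close> would do, since the
      additional square is nonnegative.\<close>
    then show ?thesis by (auto intro!: exI[of _ "[]"] add_increasing)
  qed
  then obtain u where "(\<Sum>S\<in>F. (sum ?y S)\<^sup>2) \<le> (1 + c * sum x {t. prefix t u})\<^sup>2 + c\<^sup>2" ..
  then have "family_value ?y F \<le> sqrt ((1 + c * sum x {t. prefix t u})\<^sup>2 + c\<^sup>2)"
    unfolding family_value_def by (rule real_sqrt_le_mono)
  also have "\<dots> \<le> 1 + c * sum x {t. prefix t u} + c\<^sup>2"
    by (rule sqrt_sum_squares_perturbation[OF large])
  finally show ?thesis by (rule that)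
qed

text \<open>Applying the previous estimate to \<open>x\<close> and to \<open>- x\<close> gives two
  root segments, ending at \<open>u\<close> and \<open>v\<close>; the difference of their sums is
  bounded by \<open>sum_prefixes_diff_le\<close>.\<close>

lemma jt_norm_root_perturbation:
  assumes x: "jt_finite x" "jt_norm x \<le> 1" and c: "0 < c" "c \<le> 1/2"
  shows "jt_norm (\<lambda>t. root_fun t + c * x t) + jt_norm (\<lambda>t. root_fun t - c * x t)
    \<le> 2 + sqrt 2 * c + 2 * c\<^sup>2"
proof -
  let ?p = "\<lambda>t. root_fun t + c * x t" and ?m = "\<lambda>t. root_fun t - c * x t"
  have mx: "jt_finite (\<lambda>t. - x t)" "jt_norm (\<lambda>t. - x t) \<le> 1"
    using jt_finite_scale[OF x(1), of "-1"] jt_norm_scale[OF x(1), of "-1"] x(2) by simp_all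
  have "family_value ?p F + family_value ?m G \<le> 2 + sqrt 2 * c + 2 * c\<^sup>2"
    if FG: "F \<in> segment_families" "G \<in> segment_families" for F G
  proof -
    obtain u where u: "family_value ?p F \<le> 1 + c * sum x {t. prefix t u} + c\<^sup>2"
      using family_value_root_perturbation[OF x c FG(1)] .
    obtain v where v: "family_value ?m G \<le> 1 - c * sum x {t. prefix t v} + c\<^sup>2"
      using family_value_root_perturbation[OF mx c FG(2)] by (auto simp: sum_negf)
    have "sum x {t. prefix t u} - sum x {t. prefix t v} \<le> sqrt 2 * 1"
      using sum_prefixes_diff_le[OF x(1)] x(2)
      by (meson mult_left_mono order_trans real_sqrt_ge_zero zero_le_numeral)
    then have "c * (sum x {t. prefix t u} - sum x {t. prefix t v}) \<le> c * sqrt 2"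
      using c by (intro mult_left_mono) auto
    then show ?thesis using u v by (simp add: algebra_simps)
  qed
  \<comment> \<open>The two suprema are taken one after the other: over \<open>G\<close> with
    \<open>F\<close> fixed, then over \<open>F\<close>.\<close>
  then have "jt_norm ?m \<le> 2 + sqrt 2 * c + 2 * c\<^sup>2 - family_value ?p F"
    if "F \<in> segment_families" for F
    using that by (intro jt_norm_le) (simp add: algebra_simps)
  then have "jt_norm ?p \<le> 2 + sqrt 2 * c + 2 * c\<^sup>2 - jt_norm ?m"
    by (intro jt_norm_le) (simp add: algebra_simps)
  then show ?thesis by simp
qed

lemma norm_root_perturbation:
  assumes "norm x \<le> 1" "0 < c" "c \<le> 1/2"
  shows "norm (jt_of root_fun + c *\<^sub>R x) + norm (jt_of root_fun - c *\<^sub>R x)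
    \<le> 2 + sqrt 2 * c + 2 * c\<^sup>2"
  using jt_norm_root_perturbation[OF jt_finite_coord, of x c] assms
  by (simp add: norm_jt.rep_eq plus_jt.rep_eq minus_jt.rep_eq scaleR_jt.rep_eq
      jt_coord_jt_of finitely_nonzero_root_fun)

section \<open>From the norm estimate to the diameter of a slice\<close>

lemma blinfun_apply_le_norm:
  fixes f :: "'a::real_normed_vector \<Rightarrow>\<^sub>L real"
  assumes "norm f \<le> 1"
  shows "f x \<le> norm x"
proof -
  have "f x \<le> norm f * norm x" using norm_blinfun[of f x] by simp
  also have "\<dots> \<le> 1 * norm x" using assms by (intro mult_right_mono) auto
  finally show ?thesis by simp
qed

text \<open>Test \<open>f\<close> at e + c x and \<open>g\<close> at e - c x, where e is
  \<open>jt_of root_fun\<close>. The values add up to f(e) + g(e) + c (f - g)(x). The norm estimate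
  and the slice condition each lose 2 c^2, hence 4 c after division by c.\<close>

lemma functional_diff_le:
  fixes f g :: "jt \<Rightarrow>\<^sub>L real"
  assumes "norm f \<le> 1" "norm g \<le> 1" and c: "0 < c" "c \<le> 1/2" and x: "norm x \<le> 1"
    and "f (jt_of root_fun) > 1 - c\<^sup>2" "g (jt_of root_fun) > 1 - c\<^sup>2"
  shows "(f - g) x \<le> sqrt 2 + 4 * c"
proof -
  let ?e = "jt_of root_fun"
  have "f (?e + c *\<^sub>R x) + g (?e - c *\<^sub>R x) \<le> 2 + sqrt 2 * c + 2 * c\<^sup>2"
    using norm_root_perturbation[OF x c] blinfun_apply_le_norm[OF assms(1), of "?e + c *\<^sub>R x"]
      blinfun_apply_le_norm[OF assms(2), of "?e - c *\<^sub>R x"] by linarith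
  then have "c * (f x - g x) \<le> sqrt 2 * c + 4 * c\<^sup>2"
    using assms(6,7)
    by (simp add: blinfun.add_right blinfun.diff_right blinfun.scaleR_right right_diff_distrib)
  also have "\<dots> = c * (sqrt 2 + 4 * c)" by (simp add: power2_eq_square algebra_simps)
  finally show ?thesis using c by (simp add: blinfun.diff_left)
qed

lemma norm_functional_diff_le:
  fixes f g :: "jt \<Rightarrow>\<^sub>L real"
  assumes "norm f \<le> 1" "norm g \<le> 1" and c: "0 < c" "c \<le> 1/2"
    and "f (jt_of root_fun) > 1 - c\<^sup>2" "g (jt_of root_fun) > 1 - c\<^sup>2"
  shows "norm (f - g) \<le> sqrt 2 + 4 * c"
proof (rule norm_blinfun_bound)
  fix x
  \<comment> \<open>The one-sided bound is used at \<open>sgn x\<close> and at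
    \<open>- sgn x\<close>, both of norm at most 1 even when \<open>x = 0\<close>.\<close>
  have "\<bar>(f - g) (sgn x)\<bar> \<le> sqrt 2 + 4 * c"
    using functional_diff_le[of f g c "sgn x"] functional_diff_le[of f g c "- sgn x"] assms
    by (simp add: norm_sgn blinfun.minus_right abs_le_iff)
  then have "norm x * \<bar>(f - g) (sgn x)\<bar> \<le> norm x * (sqrt 2 + 4 * c)"
    by (intro mult_left_mono) auto
  moreover have "(f - g) x = norm x * (f - g) (sgn x)"
    by (cases "x = 0") (simp_all add: sgn_div_norm blinfun.scaleR_right)
  ultimately show "norm ((f - g) x) \<le> (sqrt 2 + 4 * c) * norm x"
    by (simp add: abs_mult mult.commute)
qed (use c in auto)

text \<open>The vector e seen as a functional on the predual.\<close>

lift_definition root_eval :: "binf \<Rightarrow>\<^sub>L real" is "\<lambda>f. blinfun_apply (Rep_binf f) (jt_of root_fun)"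
proof (rule bounded_linear_intro[where K="norm (jt_of root_fun)"])
  fix f g :: binf and r :: real
  show "Rep_binf (f + g) (jt_of root_fun) = Rep_binf f (jt_of root_fun) + Rep_binf g (jt_of root_fun)"
    by (simp add: plus_binf.rep_eq blinfun.add_left)
  show "Rep_binf (r *\<^sub>R f) (jt_of root_fun) = r *\<^sub>R Rep_binf f (jt_of root_fun)"
    by (simp add: scaleR_binf.rep_eq blinfun.scaleR_left)
  show "norm (Rep_binf f (jt_of root_fun)) \<le> norm f * norm (jt_of root_fun)"
    unfolding norm_binf.rep_eq by (rule norm_blinfun)
qed

text \<open>The coordinate functional at the root lies in the unit ball and takes the value 1 at e.
  Thus membership in the slice of depth c^2 forces f(e) > 1 - c^2.\<close>

lemma one_le_SUP_root_eval: "1 \<le> (SUP f\<in>cball 0 1. root_eval f)"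
proof (rule cSUP_upper2)
  have "coord_functional [] \<in> binf_carrier"
    unfolding binf_carrier_def by (intro subsetD[OF closure_subset] span_base rangeI)
  then have rep: "Rep_binf (Abs_binf (coord_functional [])) = coord_functional []"
    by (rule Abs_binf_inverse)
  have "norm (coord_functional []) \<le> 1"
    by (rule norm_blinfun_bound)
      (simp_all add: coord_functional.rep_eq norm_jt.rep_eq abs_le_jt_norm jt_finite_coord)
  then show "Abs_binf (coord_functional []) \<in> cball 0 1"
    by (simp add: norm_binf.rep_eq rep)
  show "1 \<le> root_eval (Abs_binf (coord_functional []))"
    by (simp add: root_eval.rep_eq rep coord_functional.rep_eq jt_coord_jt_of
        finitely_nonzero_root_fun root_fun_def)
  show "bdd_above (root_eval ` cball 0 1)"
  proof (rule bdd_aboveI2)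
    fix f :: binf assume "f \<in> cball 0 1"
    then show "root_eval f \<le> norm (jt_of root_fun)"
      unfolding root_eval.rep_eq by (intro blinfun_apply_le_norm) (simp add: norm_binf.rep_eq)
  qed
qed

lemma diameter_root_slice_le:
  assumes "0 < c" "c \<le> 1/2"
  shows "diameter (slice (cball 0 1) root_eval (c\<^sup>2)) \<le> sqrt 2 + 4 * c"
proof (rule diameter_le)
  have *: "norm (Rep_binf f) \<le> 1" "Rep_binf f (jt_of root_fun) > 1 - c\<^sup>2"
    if "f \<in> slice (cball 0 1) root_eval (c\<^sup>2)" for f
    using that one_le_SUP_root_eval
    by (auto simp: slice_def norm_binf.rep_eq root_eval.rep_eq)
  fix f g
  assume "f \<in> slice (cball 0 1) root_eval (c\<^sup>2)" "g \<in> slice (cball 0 1) root_eval (c\<^sup>2)"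
  then show "norm (f - g) \<le> sqrt 2 + 4 * c"
    unfolding norm_binf.rep_eq minus_binf.rep_eq
    using assms by (intro norm_functional_diff_le *)
qed (use assms in auto)

section \<open>Comparison of the diameter two properties and conclusion\<close>

lemma slice_nonempty:
  assumes "A \<noteq> {}" "\<alpha> > 0"
  shows "slice A \<phi> \<alpha> \<noteq> {}"
proof -
  have "\<exists>y\<in>A. (SUP y\<in>A. \<phi> y) - \<alpha> < \<phi> y"
  proof (rule ccontr)
    assume "\<not> ?thesis"
    then have "(SUP y\<in>A. \<phi> y) \<le> (SUP y\<in>A. \<phi> y) - \<alpha>"
      using assms(1) by (intro cSUP_least) force+
    then show False using assms(2) by simp
  qed
  then show ?thesis by (auto simp: slice_def)
qed

lemma openin_weak_slice: "openin (subtopology weak_topology A) (slice A \<phi> \<alpha>)"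
proof -
  have "openin weak_topology (blinfun_apply \<phi> -` {(SUP y\<in>A. \<phi> y) - \<alpha><..})"
    unfolding weak_topology_def
    by (intro topology_generated_by_Basis CollectI exI[of _ \<phi>] conjI refl
        exI[of _ "{(SUP y\<in>A. \<phi> y) - \<alpha><..}"] open_greaterThan)
  moreover have "slice A \<phi> \<alpha> = blinfun_apply \<phi> -` {(SUP y\<in>A. \<phi> y) - \<alpha><..} \<inter> A"
    by (auto simp: slice_def)
  ultimately show ?thesis unfolding openin_subtopology by blast
qed

lemma ball_slices_subset_convex_combinations:
  assumes "S \<in> ball_slices"
  shows "S \<in> convex_combinations_of_slices"
proof -
  \<comment> \<open>A slice is the convex combination with a single term of weight 1.\<close>
  have "S = {\<Sum>i<(1::nat). 1 *\<^sub>R s i | s. \<forall>i<1. s i \<in> S}" by auto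
  then show ?thesis
    unfolding convex_combinations_of_slices_def using assms
    by (intro CollectI exI[of _ 1] exI[of _ "\<lambda>_. 1"] exI[of _ "\<lambda>_. S"]) auto
qed

text \<open>Slices of the ball are themselves non-empty and relatively weakly open.\<close>

lemma diameter_two_imp_slice_diameter_two:
  assumes "diameter_two TYPE('a::banach)"
  shows "slice_diameter_two TYPE('a)"
  unfolding slice_diameter_two_def
proof
  fix S :: "'a set" assume "S \<in> ball_slices"
  then obtain \<phi> \<alpha> where S: "S = slice (cball 0 1) \<phi> \<alpha>" "\<alpha> > 0"
    unfolding ball_slices_def by blast
  have "S \<noteq> {}" unfolding S(1) by (rule slice_nonempty) (use S(2) in auto)
  moreover have "openin (subtopology weak_topology (cball 0 1)) S"
    unfolding S(1) by (rule openin_weak_slice)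
  ultimately show "diameter S = 2" using assms unfolding diameter_two_def by blast
qed

lemma strong_diameter_two_imp_slice_diameter_two:
  "strong_diameter_two TYPE('a::banach) \<Longrightarrow> slice_diameter_two TYPE('a)"
  unfolding strong_diameter_two_def slice_diameter_two_def
  using ball_slices_subset_convex_combinations by blast

theorem mainTheorem2:
  shows "Inf {diameter (slice (cball 0 1) \<phi> \<alpha>) | (\<phi> :: binf \<Rightarrow>\<^sub>L real) (\<alpha> :: real). \<alpha> > 0} \<le> sqrt 2
    \<and> \<not> slice_diameter_two TYPE(binf)
    \<and> \<not> diameter_two TYPE(binf)
    \<and> \<not> strong_diameter_two TYPE(binf)"
proof -
  let ?D = "{diameter (slice (cball 0 1) \<phi> \<alpha>) | (\<phi> :: binf \<Rightarrow>\<^sub>L real) (\<alpha> :: real). \<alpha> > 0}"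
  have "bounded (slice (cball 0 1) \<phi> \<alpha>)" for \<phi> :: "binf \<Rightarrow>\<^sub>L real" and \<alpha>
    by (rule bounded_subset[OF bounded_cball[of 0 1]]) (auto simp: slice_def)
  \<comment> \<open>A lower bound is required for \<open>Inf\<close> to lie below each member;
    diameters of bounded sets are nonnegative.\<close>
  then have bdd: "bdd_below ?D" by (intro bdd_belowI[of _ 0]) (auto intro: diameter_ge_0)
  have "Inf ?D \<le> sqrt 2 + \<epsilon>" if "\<epsilon> > 0" for \<epsilon>
  proof -
    \<comment> \<open>The bound 1/2 is the range of the slice estimate, and \<epsilon>/4 absorbs its
      error 4 c.\<close>
    define c where "c = min (1/2) (\<epsilon>/4)"
    have c: "0 < c" "c \<le> 1/2" "4 * c \<le> \<epsilon>" using that by (auto simp: c_def)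
    have "diameter (slice (cball 0 1) root_eval (c\<^sup>2)) \<in> ?D"
      using c(1) by (intro CollectI exI[of _ root_eval] exI[of _ "c\<^sup>2"]) simp
    then have "Inf ?D \<le> diameter (slice (cball 0 1) root_eval (c\<^sup>2))"
      using bdd by (rule cInf_lower)
    then show ?thesis using diameter_root_slice_le[OF c(1,2)] c(3) by linarith
  qed
  then have inf: "Inf ?D \<le> sqrt 2" by (rule field_le_epsilon)
  \<comment> \<open>With c = 1/8 the estimate gives sqrt 2 + 1/2 < 2, so one explicit slice refutes
    the slice property.\<close>
  have "sqrt 2 < 3/2" by (rule real_less_lsqrt) (auto simp: power2_eq_square)
  then have "diameter (slice (cball 0 1) root_eval ((1/8)\<^sup>2)) < 2"
    using diameter_root_slice_le[of "1/8"] by simp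
  moreover have "slice (cball 0 1) root_eval ((1/8)\<^sup>2) \<in> ball_slices"
    unfolding ball_slices_def by (intro CollectI exI[of _ root_eval] exI[of _ "(1/8)\<^sup>2"]) simp
  ultimately have "\<not> slice_diameter_two TYPE(binf)"
    unfolding slice_diameter_two_def by (metis less_irrefl)
  then show ?thesis
    using inf diameter_two_imp_slice_diameter_two strong_diameter_two_imp_slice_diameter_two
    by blast
qed

end
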